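(* Let $q$ be a prime power, $\sigma$ a generator of $\mathrm{Gal}(\mathbb{F}_{q^5}/\mathbb{F}_q)$, and $L=ax+bx^{\sigma}+cx^{\sigma^2}+dx^{\sigma^3}$ with $a,b,c,d\in\mathbb{F}_{q^5}$ and $abcd\neq0$. Let $w=\frac{a^\sigma c}{b^{\sigma+1}}$ and $z=\frac{b^\sigma d}{c^{\sigma+1}}$. Then $P_L(y)=a+by+cy^{\sigma+1}+dy^{\sigma^2+\sigma+1}$ has $q^2+q+1$ roots in $\mathbb{F}_{q^5}$ if and only if $z^{\sigma^2+1}+z^{\sigma}-1=0$ and $z^{\sigma}+z-1-w^{\sigma}z^{1+\sigma}=0$. Also, $L$ has $q^3$ roots in $\mathbb{F}_{q^5}$ if and only if $z^{\sigma^2+1}+z^{\sigma}-1=0$, $z^{\sigma}+z-1-w^{\sigma}z^{1+\sigma}=0$, and $N(z)N(c/d)=-1$.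
   Context: $N(x)=x^{1+\sigma+\sigma^2+\sigma^3+\sigma^4}$ is the norm $\mathbb{F}_{q^5}\to\mathbb{F}_q$. *)

theory Defs
  imports "HOL-Algebra.Generated_Groups" "HOL-Number_Theory.Prime_Powers"
    "HOL-Computational_Algebra.Primes" "HOL-Library.Cardinality"
begin

definition is_subfield :: "'a::field set \<Rightarrow> bool" where
  "is_subfield F \<longleftrightarrow> 0 \<in> F \<and> 1 \<in> F \<and>
     (\<forall>x\<in>F. \<forall>y\<in>F. x + y \<in> F \<and> x * y \<in> F) \<and> (\<forall>x\<in>F. - x \<in> F \<and> inverse x \<in> F)"

text \<open>The preservation of \<open>1\<close> is implied, since an automorphism over \<open>F\<close> fixes \<open>F\<close> pointwise and
  \<open>1 \<in> F\<close> for a subfield \<open>F\<close>.\<close>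

definition Gal :: "'a::field set \<Rightarrow> ('a \<Rightarrow> 'a) monoid" where
  "Gal F = \<lparr>carrier = {f. bij f \<and> (\<forall>x y. f (x + y) = f x + f y) \<and>
                           (\<forall>x y. f (x * y) = f x * f y) \<and> (\<forall>x\<in>F. f x = x)},
            monoid.mult = (\<circ>), one = id\<rparr>"

text \<open>Below, exponents from the group ring of \<open>\<langle>\<sigma>\<rangle>\<close> are written out: \<open>x\<close> to the power \<open>\<sigma>\<close> is
  \<open>\<sigma> x\<close>, \<open>x\<close> to the power \<open>\<sigma>\<^sup>2\<close> is \<open>\<sigma> (\<sigma> x)\<close>, and sums of exponents become products.\<close>

definition norm5 :: "('a::field \<Rightarrow> 'a) \<Rightarrow> 'a \<Rightarrow> 'a" where
  "norm5 \<sigma> x = (\<Prod>i<5. (\<sigma> ^^ i) x)"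

definition lin_poly :: "('a::field \<Rightarrow> 'a) \<Rightarrow> 'a \<Rightarrow> 'a \<Rightarrow> 'a \<Rightarrow> 'a \<Rightarrow> 'a \<Rightarrow> 'a" where
  "lin_poly \<sigma> a b c d x = a * x + b * \<sigma> x + c * \<sigma> (\<sigma> x) + d * \<sigma> (\<sigma> (\<sigma> x))"

definition proj_poly :: "('a::field \<Rightarrow> 'a) \<Rightarrow> 'a \<Rightarrow> 'a \<Rightarrow> 'a \<Rightarrow> 'a \<Rightarrow> 'a \<Rightarrow> 'a" where
  "proj_poly \<sigma> a b c d y = a + b * y + c * (\<sigma> y * y) + d * (\<sigma> (\<sigma> y) * \<sigma> y * y)"

end

theory Submission
  imports Defs "HOL-Number_Theory.Residues" "HOL-Computational_Algebra.Polynomial"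
begin

text \<open>
  A nonzero operator \<open>\<Sum>i\<le>k. r\<^sub>i \<sigma>\<^sup>i\<close> has at most \<open>q\<^sup>k\<close> roots. Hence \<open>L\<close>, of degree three in \<open>\<sigma>\<close>, has
  \<open>q\<^sup>3\<close> roots if and only if it divides \<open>\<sigma>\<^sup>5 - 1\<close> on the right in the skew polynomial ring:
  the remainder of \<open>\<sigma>\<^sup>5 - 1\<close> vanishes on the kernel of \<open>L\<close> and has degree at most two, and
  conversely the quotient kills the image of \<open>L\<close>. The vanishing of the coefficients of
  \<open>\<sigma>\<close> and \<open>\<sigma>\<^sup>2\<close> in the remainder of \<open>\<sigma>\<^sup>5\<close> gives the two conditions on \<open>w\<close> and \<open>z\<close>, under
  which the constant coefficient is \<open>- N(z) N(c/d)\<close>.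

  If \<open>\<theta>\<close> is nonzero, then by Hilbert 90 the roots of \<open>P\<^sub>L\<close> of norm \<open>N(\<theta>)\<close> are the elements
  \<open>\<theta> \<sigma> x / x\<close>, with \<open>x\<close> a nonzero root of a twist of \<open>L\<close> that has the same \<open>w\<close> and \<open>z\<close>. If some twist
  has \<open>q\<^sup>3\<close> roots, then all roots of \<open>P\<^sub>L\<close> have the same norm and there are \<open>q\<^sup>2 + q + 1\<close> of them.
  Otherwise every twist has at most \<open>q\<^sup>2\<close> roots, so that \<open>P\<^sub>L\<close> has at most \<open>(q - 1) (q + 1)\<close> roots.
\<close>

section \<open>Linear combinations of powers of a field endomorphism\<close>

locale field_endomorphism =
  fixes \<sigma> :: "'a::finite_field \<Rightarrow> 'a"
  assumes hom_add: "\<sigma> (x + y) = \<sigma> x + \<sigma> y"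
    and hom_mult: "\<sigma> (x * y) = \<sigma> x * \<sigma> y"
    and hom_one: "\<sigma> 1 = 1"
begin

section \<open>Elementary properties of field endomorphisms\<close>

lemma hom_zero: "\<sigma> 0 = 0"
  using hom_add[of 0 0] by (metis add_0 add_cancel_right_right)

lemma hom_minus: "\<sigma> (- x) = - \<sigma> x"
  using hom_add[of x "- x"] hom_zero by (simp add: eq_neg_iff_add_eq_0 add.commute)

lemma hom_diff: "\<sigma> (x - y) = \<sigma> x - \<sigma> y"
  using hom_add[of x "- y"] hom_minus[of y] by simp

lemma hom_eq_0_iff: "\<sigma> x = 0 \<longleftrightarrow> x = 0"
proof
  assume "\<sigma> x = 0"
  then have "x \<noteq> 0 \<Longrightarrow> \<sigma> (x * inverse x) = 0"
    unfolding hom_mult by simp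
  then show "x = 0"
    using hom_one by auto
qed (simp add: hom_zero)

lemma hom_divide: "\<sigma> (x / y) = \<sigma> x / \<sigma> y"
proof (cases "y = 0")
  case False
  then have "\<sigma> x = \<sigma> (x / y) * \<sigma> y"
    by (simp flip: hom_mult)
  with False show ?thesis
    by (simp add: hom_eq_0_iff)
qed (simp add: hom_zero)

lemmas hom_simps = hom_add hom_mult hom_one hom_zero hom_minus hom_diff hom_eq_0_iff hom_divide

lemma funpow_hom_mult: "(\<sigma> ^^ i) (x * y) = (\<sigma> ^^ i) x * (\<sigma> ^^ i) y"
  by (induction i) (simp_all add: hom_mult)

lemma funpow_hom_diff: "(\<sigma> ^^ i) (x - y) = (\<sigma> ^^ i) x - (\<sigma> ^^ i) y"
  by (induction i) (simp_all add: hom_diff)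

lemma funpow_hom_eq_0_iff: "(\<sigma> ^^ i) x = 0 \<longleftrightarrow> x = 0"
  by (induction i) (simp_all add: hom_eq_0_iff)

lemma card_fixed_pos: "card {x. \<sigma> x = x} > 0"
  using hom_zero by (auto simp: card_gt_0_iff)

text \<open>Each fibre of the additive map \<open>t \<mapsto> \<sigma> t - t\<close> is empty or a
  coset of the fixed field.\<close>

lemma card_vimage_difference_le:
  "card {t. \<sigma> t - t \<in> S} \<le> card {x. \<sigma> x = x} * card S"
proof -
  have "card {t. \<sigma> t - t = s} \<le> card {x. \<sigma> x = x}" for s
  proof (cases "\<exists>t0. \<sigma> t0 - t0 = s")
    case True
    then obtain t0 where "\<sigma> t0 - t0 = s" by blast
    then have "(\<lambda>t. t - t0) ` {t. \<sigma> t - t = s} \<subseteq> {x. \<sigma> x = x}"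
      by (auto simp: hom_diff algebra_simps)
    then show ?thesis
      by (intro card_inj_on_le[of "\<lambda>t. t - t0"]) (auto simp: inj_on_def)
  qed auto
  then have "(\<Sum>s\<in>S. card {t. \<sigma> t - t = s}) \<le> card S * card {x. \<sigma> x = x}"
    using sum_bounded_above[of S "\<lambda>s. card {t. \<sigma> t - t = s}"] by simp
  moreover have "{t. \<sigma> t - t \<in> S} = (\<Union>s\<in>S. {t. \<sigma> t - t = s})"
    by auto
  moreover have "card (\<Union>s\<in>S. {t. \<sigma> t - t = s}) \<le> (\<Sum>s\<in>S. card {t. \<sigma> t - t = s})"
    by (rule card_UN_le) simp
  ultimately show ?thesis
    by (simp add: mult.commute)
qed

text \<open>Abel summation. When the \<open>e j\<close> sum to zero, the boundary term drops out and
  only differences of consecutive \<open>s i\<close> remain.\<close>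

lemma sum_by_parts:
  fixes e s :: "nat \<Rightarrow> 'a"
  shows "(\<Sum>i\<le>Suc k. e i * s i) =
    (\<Sum>i\<le>k. - (\<Sum>j\<le>i. e j) * (s (Suc i) - s i)) + (\<Sum>j\<le>Suc k. e j) * s (Suc k)"
  by (induction k) (simp_all add: algebra_simps)

text \<open>If \<open>u\<close> is a nonzero root, then substituting \<open>x = u t\<close> and summing by parts factors the
  operator through \<open>t \<mapsto> \<sigma> t - t\<close>, which lowers the degree by one.\<close>

lemma card_roots_le:
  fixes c :: "nat \<Rightarrow> 'a"
  assumes "\<exists>i\<le>k. c i \<noteq> 0"
  shows "card {x. (\<Sum>i\<le>k. c i * (\<sigma> ^^ i) x) = 0} \<le> card {x. \<sigma> x = x} ^ k"
  using assms
proof (induction k arbitrary: c)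
  case 0
  then show ?case by simp
next
  case (Suc k)
  define q where "q = card {x. \<sigma> x = x}"
  have q: "q > 0" unfolding q_def by (rule card_fixed_pos)
  define Z where "Z = {x. (\<Sum>i\<le>Suc k. c i * (\<sigma> ^^ i) x) = 0}"
  show ?case
  proof (cases "\<exists>u\<in>Z. u \<noteq> 0")
    case False
    then have "card Z \<le> card {0::'a}"
      by (intro card_mono) auto
    then show ?thesis
      using q unfolding Z_def[symmetric] q_def[symmetric]
      by (metis card_1_singleton_iff dual_order.trans nat_one_le_power One_nat_def Suc_leI)
  next
    case True
    then obtain u where u: "u \<in> Z" "u \<noteq> 0" by blast
    define e where "e i = c i * (\<sigma> ^^ i) u" for i
    define f where "f i = - (\<Sum>j\<le>i. e j)" for i
    have total: "(\<Sum>j\<le>Suc k. e j) = 0"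
      using u unfolding Z_def e_def by simp
    \<comment> \<open>If all partial sums vanish, so do all \<open>e i\<close>, and then all
      \<open>c i\<close>, because the powers of \<open>\<sigma>\<close> send \<open>u\<close> to
      nonzero elements.\<close>
    have f_nz: "\<exists>i\<le>k. f i \<noteq> 0"
    proof (rule ccontr)
      assume "\<not> ?thesis"
      then have E: "(\<Sum>j\<le>i. e j) = 0" if "i \<le> Suc k" for i
        using total that by (cases "i = Suc k") (auto simp: f_def)
      have "e i = 0" if "i \<le> Suc k" for i
      proof (cases i)
        case 0
        then show ?thesis using E[of 0] by simp
      next
        case (Suc j)
        then show ?thesis using E[of j] E[of "Suc j"] that by simp
      qed
      then show False
        using Suc.prems u(2) by (auto simp: e_def funpow_hom_eq_0_iff)
    qed
    define S where "S = {y. (\<Sum>i\<le>k. f i * (\<sigma> ^^ i) y) = 0}"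
    have "Z \<subseteq> (\<lambda>t. u * t) ` {t. \<sigma> t - t \<in> S}"
    proof
      fix x assume x: "x \<in> Z"
      define t where "t = x / u"
      have xt: "x = u * t" using u by (simp add: t_def)
      have "(\<Sum>i\<le>Suc k. e i * (\<sigma> ^^ i) t) = 0"
        using x unfolding Z_def xt e_def by (simp only: mem_Collect_eq funpow_hom_mult mult.assoc)
      then have "(\<Sum>i\<le>k. f i * ((\<sigma> ^^ Suc i) t - (\<sigma> ^^ i) t)) = 0"
        unfolding sum_by_parts f_def total by simp
      then have "\<sigma> t - t \<in> S"
        unfolding S_def by (simp add: funpow_hom_diff funpow_swap1)
      then show "x \<in> (\<lambda>t. u * t) ` {t. \<sigma> t - t \<in> S}"
        using xt by blast
    qed
    then have "card Z \<le> card ((\<lambda>t. u * t) ` {t. \<sigma> t - t \<in> S})"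
      by (intro card_mono) auto
    also have "\<dots> \<le> card {t. \<sigma> t - t \<in> S}"
      by (rule card_image_le) simp
    also have "\<dots> \<le> q * card S"
      unfolding q_def by (rule card_vimage_difference_le)
    also have "\<dots> \<le> q * q ^ k"
      using Suc.IH[OF f_nz] by (simp add: S_def q_def)
    finally show ?thesis
      by (simp add: Z_def q_def)
  qed
qed

lemma card_roots_2_le:
  assumes "r0 \<noteq> 0 \<or> r1 \<noteq> 0 \<or> r2 \<noteq> 0"
  shows "card {x. r0 * x + r1 * \<sigma> x + r2 * \<sigma> (\<sigma> x) = 0} \<le> card {x. \<sigma> x = x} ^ 2"
proof -
  have "\<exists>i\<le>2. ([r0, r1, r2] ! i) \<noteq> 0"
    using assms by (auto simp: numeral_eq_Suc le_Suc_eq ex_disj_distrib conj_disj_distribR)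
  from card_roots_le[OF this] show ?thesis
    by (simp add: numeral_eq_Suc)
qed

lemma card_roots_3_le:
  assumes "r0 \<noteq> 0 \<or> r1 \<noteq> 0 \<or> r2 \<noteq> 0 \<or> r3 \<noteq> 0"
  shows "card {x. r0 * x + r1 * \<sigma> x + r2 * \<sigma> (\<sigma> x) + r3 * \<sigma> (\<sigma> (\<sigma> x)) = 0}
    \<le> card {x. \<sigma> x = x} ^ 3"
proof -
  have "\<exists>i\<le>3. ([r0, r1, r2, r3] ! i) \<noteq> 0"
    using assms by (auto simp: numeral_eq_Suc le_Suc_eq ex_disj_distrib conj_disj_distribR)
  from card_roots_le[OF this] show ?thesis
    by (simp add: numeral_eq_Suc)
qed

end


section \<open>Cyclic extensions of degree five\<close>

text \<open>The counting arguments need only these properties of \<open>\<sigma>\<close>. The last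
  section derives them for a generator of the Galois group.\<close>

locale cyclic_quintic = field_endomorphism \<sigma> for \<sigma> :: "'a::finite_field \<Rightarrow> 'a" +
  fixes q :: nat
  assumes five: "\<sigma> (\<sigma> (\<sigma> (\<sigma> (\<sigma> x)))) = x"
    and card_fixed: "card {x. \<sigma> x = x} = q"
    and card_field: "CARD('a) = q ^ 5"
begin

lemma q_gt_1: "q > 1"
proof -
  have "card {0, 1 :: 'a} \<le> card {x. \<sigma> x = x}"
    by (rule card_mono) (auto simp: hom_simps)
  then show ?thesis using card_fixed by simp
qed

section \<open>The norm and Hilbert 90\<close>

lemma norm5_eq: "norm5 \<sigma> x = x * \<sigma> x * \<sigma> (\<sigma> x) * \<sigma> (\<sigma> (\<sigma> x)) * \<sigma> (\<sigma> (\<sigma> (\<sigma> x)))"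
  by (simp add: norm5_def numeral_eq_Suc)

lemma norm5_eq_0_iff: "norm5 \<sigma> x = 0 \<longleftrightarrow> x = 0"
  by (simp add: norm5_eq hom_simps)

lemma hom_norm5: "\<sigma> (norm5 \<sigma> x) = norm5 \<sigma> x"
  by (simp add: norm5_eq hom_simps five)

lemma norm5_mult: "norm5 \<sigma> (x * y) = norm5 \<sigma> x * norm5 \<sigma> y"
  by (simp add: norm5_eq hom_simps)

lemma norm5_divide: "norm5 \<sigma> (x / y) = norm5 \<sigma> x / norm5 \<sigma> y"
  by (simp add: norm5_eq hom_simps)

lemma norm5_minus: "norm5 \<sigma> (- x) = - norm5 \<sigma> x"
  by (simp add: norm5_eq hom_simps)

lemma norm5_hom: "norm5 \<sigma> (\<sigma> x) = norm5 \<sigma> x"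
  by (simp add: norm5_eq five)

text \<open>The weights satisfy \<open>\<sigma> (v ! i) = y * v ! (i + 1)\<close>, indices modulo
  five, so the Lagrange resolvent satisfies \<open>\<sigma> (h t) = y * h t\<close>. It has degree
  four in \<open>\<sigma>\<close>, hence at most \<open>q ^ 4\<close> zeros, and is nonzero at some
  \<open>t\<close>.\<close>

lemma hilbert_90:
  assumes "norm5 \<sigma> y = 1"
  obtains x where "x \<noteq> 0" "\<sigma> x = y * x"
proof -
  define v where "v = [1, 1 / y, 1 / (y * \<sigma> y), 1 / (y * \<sigma> y * \<sigma> (\<sigma> y)),
    1 / (y * \<sigma> y * \<sigma> (\<sigma> y) * \<sigma> (\<sigma> (\<sigma> y)))]"
  define h where "h t = (\<Sum>i\<le>4. v ! i * (\<sigma> ^^ i) t)" for t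
  have "\<exists>i\<le>4. v ! i \<noteq> 0"
    by (intro exI[of _ 0]) (simp add: v_def)
  then have "card {t. h t = 0} \<le> q ^ 4"
    using card_roots_le[of 4 "(!) v"] unfolding h_def card_fixed by blast
  also have "\<dots> < q ^ 5"
    using q_gt_1 by (intro power_strict_increasing) auto
  finally have "{t. h t = 0} \<noteq> UNIV"
    using card_field by auto
  then obtain t where t: "h t \<noteq> 0" by auto
  have nz: "y \<noteq> 0" using assms norm5_eq_0_iff[of y] by auto
  \<comment> \<open>Norm one closes the cycle: \<open>\<sigma>\<close> maps the last weight to
    \<open>y\<close> times the first.\<close>
  have *: "1 / (\<sigma> y * \<sigma> (\<sigma> y) * \<sigma> (\<sigma> (\<sigma> y)) * \<sigma> (\<sigma> (\<sigma> (\<sigma> y)))) = y"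
    using assms nz by (simp add: norm5_eq hom_simps divide_simps mult.assoc)
  have "\<sigma> (h t) = \<sigma> t + (1 / \<sigma> y) * \<sigma> (\<sigma> t) + (1 / (\<sigma> y * \<sigma> (\<sigma> y))) * \<sigma> (\<sigma> (\<sigma> t))
    + (1 / (\<sigma> y * \<sigma> (\<sigma> y) * \<sigma> (\<sigma> (\<sigma> y)))) * \<sigma> (\<sigma> (\<sigma> (\<sigma> t)))
    + (1 / (\<sigma> y * \<sigma> (\<sigma> y) * \<sigma> (\<sigma> (\<sigma> y)) * \<sigma> (\<sigma> (\<sigma> (\<sigma> y))))) * t"
    by (simp add: h_def v_def numeral_eq_Suc hom_simps five)
  also have "\<dots> = y * h t"
    unfolding * using nz
    by (simp add: h_def v_def numeral_eq_Suc hom_simps distrib_left)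
  finally show ?thesis
    using that t by blast
qed


subsection \<open>Right division of the fifth power\<close>

text \<open>The coefficients of the remainder of \<open>\<sigma>\<^sup>5\<close> under right division by
  \<open>\<sigma>\<^sup>3 - C \<sigma>\<^sup>2 - B \<sigma> - A\<close> in the skew polynomial ring.\<close>

definition rem0 :: "'a \<Rightarrow> 'a \<Rightarrow> 'a \<Rightarrow> 'a" where
  "rem0 A B C = (\<sigma> (\<sigma> C) * \<sigma> C + \<sigma> (\<sigma> B)) * A"

definition rem1 :: "'a \<Rightarrow> 'a \<Rightarrow> 'a \<Rightarrow> 'a" where
  "rem1 A B C = (\<sigma> (\<sigma> C) * \<sigma> C + \<sigma> (\<sigma> B)) * B + \<sigma> (\<sigma> C) * \<sigma> A"

definition rem2 :: "'a \<Rightarrow> 'a \<Rightarrow> 'a \<Rightarrow> 'a" where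
  "rem2 A B C = (\<sigma> (\<sigma> C) * \<sigma> C + \<sigma> (\<sigma> B)) * C + \<sigma> (\<sigma> C) * \<sigma> B + \<sigma> (\<sigma> A)"

text \<open>This serves two sequences: the iterates of \<open>\<sigma>\<close> at a kernel element,
  and the products \<open>1, y, y * \<sigma> y, ...\<close> at a root \<open>y\<close> of
  \<open>proj_poly\<close>.\<close>

lemma recurrence_fifth:
  assumes "s3 = C * s2 + B * s1 + A * s0"
    and "s4 = \<sigma> C * s3 + \<sigma> B * s2 + \<sigma> A * s1"
    and "s5 = \<sigma> (\<sigma> C) * s4 + \<sigma> (\<sigma> B) * s3 + \<sigma> (\<sigma> A) * s2"
  shows "s5 = rem0 A B C * s0 + rem1 A B C * s1 + rem2 A B C * s2"
  unfolding rem0_def rem1_def rem2_def assms by (simp add: algebra_simps)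

text \<open>The monic form of \<open>L\<close>, obtained by dividing by \<open>d\<close>, with
  \<open>A = - a / d\<close>, \<open>B = - b / d\<close> and \<open>C = - c / d\<close>.\<close>

definition cubic :: "'a \<Rightarrow> 'a \<Rightarrow> 'a \<Rightarrow> 'a \<Rightarrow> 'a" where
  "cubic A B C x = \<sigma> (\<sigma> (\<sigma> x)) - C * \<sigma> (\<sigma> x) - B * \<sigma> x - A * x"

text \<open>On the kernel, the identity \<open>\<sigma>\<^sup>5\<close> acts as the remainder. The
  kernel is thus contained in that of the remainder minus the identity, a nonzero operator of degree
  at most two.\<close>

lemma card_kernel_cubic_le:
  assumes "(rem0 A B C, rem1 A B C, rem2 A B C) \<noteq> (1, 0, 0)"
  shows "card {x. cubic A B C x = 0} \<le> q ^ 2"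
proof -
  have "card {x. cubic A B C x = 0} \<le>
      card {x. (rem0 A B C - 1) * x + rem1 A B C * \<sigma> x + rem2 A B C * \<sigma> (\<sigma> x) = 0}"
  proof (rule card_mono; safe?)
    fix x assume "cubic A B C x = 0"
    then have s3: "\<sigma> (\<sigma> (\<sigma> x)) = C * \<sigma> (\<sigma> x) + B * \<sigma> x + A * x"
      by (simp add: cubic_def algebra_simps)
    have s4: "\<sigma> (\<sigma> (\<sigma> (\<sigma> x))) = \<sigma> C * \<sigma> (\<sigma> (\<sigma> x)) + \<sigma> B * \<sigma> (\<sigma> x) + \<sigma> A * \<sigma> x"
      using arg_cong[OF s3, of \<sigma>] by (simp only: hom_simps)
    have s5: "\<sigma> (\<sigma> (\<sigma> (\<sigma> (\<sigma> x)))) = \<sigma> (\<sigma> C) * \<sigma> (\<sigma> (\<sigma> (\<sigma> x)))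
        + \<sigma> (\<sigma> B) * \<sigma> (\<sigma> (\<sigma> x)) + \<sigma> (\<sigma> A) * \<sigma> (\<sigma> x)"
      using arg_cong[OF s4, of \<sigma>] by (simp only: hom_simps)
    show "(rem0 A B C - 1) * x + rem1 A B C * \<sigma> x + rem2 A B C * \<sigma> (\<sigma> x) = 0"
      using recurrence_fifth[OF s3 s4 s5] unfolding five by (simp add: algebra_simps)
  qed simp
  also have "\<dots> \<le> q ^ 2"
    using card_roots_2_le[of "rem0 A B C - 1" "rem1 A B C" "rem2 A B C"] assms card_fixed
    by auto
  finally show ?thesis .
qed

lemma cubic_diff: "cubic A B C (x - y) = cubic A B C x - cubic A B C y"
  by (simp add: cubic_def hom_simps algebra_simps)

text \<open>The upper bound is the degree bound. For the lower bound, the image lies in the kernel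
  of the quotient, which has at most \<open>q ^ 2\<close> elements, and no fibre is larger than the
  kernel; the fibres cover all \<open>q ^ 5\<close> elements.\<close>

lemma card_kernel_cubic_eq:
  assumes "rem0 A B C = 1" "rem1 A B C = 0" "rem2 A B C = 0"
  shows "card {x. cubic A B C x = 0} = q ^ 3"
proof (rule antisym)
  have "card {x. (- A) * x + (- B) * \<sigma> x + (- C) * \<sigma> (\<sigma> x) + 1 * \<sigma> (\<sigma> (\<sigma> x)) = 0} \<le> q ^ 3"
    unfolding card_fixed[symmetric] by (rule card_roots_3_le) simp
  also have "{x. (- A) * x + (- B) * \<sigma> x + (- C) * \<sigma> (\<sigma> x) + 1 * \<sigma> (\<sigma> (\<sigma> x)) = 0}
      = {x. cubic A B C x = 0}"
    by (simp add: cubic_def algebra_simps)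
  finally show "card {x. cubic A B C x = 0} \<le> q ^ 3" .
next
  \<comment> \<open>The quotient of \<open>\<sigma>\<^sup>5\<close> by the cubic is the operator
    with coefficients \<open>m\<close>, \<open>\<sigma> (\<sigma> C)\<close> and
    \<open>1\<close>.\<close>
  define m where "m = \<sigma> (\<sigma> C) * \<sigma> C + \<sigma> (\<sigma> B)"
  define M where "M = {y. m * y + \<sigma> (\<sigma> C) * \<sigma> y + 1 * \<sigma> (\<sigma> y) = 0}"
  have M: "card M \<le> q ^ 2"
    unfolding card_fixed[symmetric] M_def by (rule card_roots_2_le) simp
  have range: "cubic A B C x \<in> M" for x
  proof -
    have "m * cubic A B C x + \<sigma> (\<sigma> C) * \<sigma> (cubic A B C x) + \<sigma> (\<sigma> (cubic A B C x))
        = x - (rem0 A B C * x + rem1 A B C * \<sigma> x + rem2 A B C * \<sigma> (\<sigma> x))"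
      unfolding cubic_def rem0_def rem1_def rem2_def m_def
      by (simp add: hom_simps five algebra_simps)
    then show ?thesis
      using assms by (simp add: M_def)
  qed
  have fibre: "card {x. cubic A B C x = s} \<le> card {x. cubic A B C x = 0}" for s
  proof (cases "\<exists>x0. cubic A B C x0 = s")
    case True
    then obtain x0 where "cubic A B C x0 = s" by blast
    then show ?thesis
      by (intro card_inj_on_le[of "\<lambda>x. x - x0"]) (auto simp: inj_on_def cubic_diff)
  qed auto
  have "q ^ 5 = card (\<Union>s\<in>M. {x. cubic A B C x = s})"
  proof -
    have "(\<Union>s\<in>M. {x. cubic A B C x = s}) = UNIV"
      using range by auto
    then show ?thesis
      using card_field by simp
  qed
  also have "\<dots> \<le> (\<Sum>s\<in>M. card {x. cubic A B C x = s})"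
    by (rule card_UN_le) simp
  also have "\<dots> \<le> card M * card {x. cubic A B C x = 0}"
    using sum_bounded_above[of M "\<lambda>s. card {x. cubic A B C x = s}"] fibre by simp
  also have "\<dots> \<le> q ^ 2 * card {x. cubic A B C x = 0}"
    using M by (rule mult_right_mono) simp
  finally have "q ^ 2 * q ^ 3 \<le> q ^ 2 * card {x. cubic A B C x = 0}"
    by (simp flip: power_add)
  then show "q ^ 3 \<le> card {x. cubic A B C x = 0}"
    by (subst (asm) nat_mult_le_cancel1) (use q_gt_1 in auto)
qed

text \<open>These conditions depend only on \<open>w\<close> and \<open>z\<close>, which are
  invariant under twisting; the norm condition is not, and is kept apart.\<close>

definition maximality_conditions :: "'a \<Rightarrow> 'a \<Rightarrow> bool" where
  "maximality_conditions w z \<longleftrightarrow>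
     \<sigma> (\<sigma> z) * z + \<sigma> z - 1 = 0 \<and> \<sigma> z + z - 1 - \<sigma> w * (z * \<sigma> z) = 0"

text \<open>Expressing the conjugates of \<open>A\<close> and \<open>B\<close> through
  \<open>w\<close>, \<open>z\<close> and \<open>C\<close> turns \<open>rem2\<close> into a nonzero
  multiple of the second condition, and \<open>\<sigma>\<close> of \<open>rem1\<close> into a
  nonzero multiple of the difference of the two.\<close>

lemma rem_vanish_iff:
  assumes "A \<noteq> 0" "B \<noteq> 0" "C \<noteq> 0"
    and w: "w = \<sigma> A * C / (\<sigma> B * B)" and z: "z = - \<sigma> B / (\<sigma> C * C)"
  shows "rem1 A B C = 0 \<and> rem2 A B C = 0 \<longleftrightarrow> maximality_conditions w z"
proof -
  let ?c0 = "C" and ?c1 = "\<sigma> C" and ?c2 = "\<sigma> (\<sigma> C)" and ?c3 = "\<sigma> (\<sigma> (\<sigma> C))"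
  have nz: "\<sigma> B \<noteq> 0" "\<sigma> (\<sigma> B) \<noteq> 0" "?c1 \<noteq> 0" "?c2 \<noteq> 0" "?c3 \<noteq> 0"
    using assms by (simp_all add: hom_simps)
  have B1: "\<sigma> B = - z * ?c1 * ?c0"
    using nz assms by (simp add: z)
  have B2: "\<sigma> (\<sigma> B) = - \<sigma> z * ?c2 * ?c1"
    using arg_cong[OF B1, of \<sigma>] by (simp only: hom_simps)
  have B3: "\<sigma> (\<sigma> (\<sigma> B)) = - \<sigma> (\<sigma> z) * ?c3 * ?c2"
    using arg_cong[OF B2, of \<sigma>] by (simp only: hom_simps)
  have A2: "\<sigma> (\<sigma> A) = \<sigma> w * (z * \<sigma> z) * (?c2 * ?c1 * ?c0)"
  proof -
    have "\<sigma> w * (\<sigma> (\<sigma> B) * \<sigma> B) = \<sigma> (\<sigma> A) * ?c1"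
      using nz by (simp add: w hom_simps)
    then have "?c1 * \<sigma> (\<sigma> A) = ?c1 * (\<sigma> w * (z * \<sigma> z) * (?c2 * ?c1 * ?c0))"
      unfolding B2 B1 by (auto simp: hom_simps mult_ac)
    then show ?thesis
      using nz by simp
  qed
  have rem2: "rem2 A B C = - (?c2 * ?c1 * ?c0) * (\<sigma> z + z - 1 - \<sigma> w * (z * \<sigma> z))"
    unfolding rem2_def A2 B2 B1 by (simp add: hom_simps algebra_simps)
  \<comment> \<open>The definition of \<open>z\<close> gives \<open>\<sigma> B\<close> rather than
    \<open>B\<close>, so \<open>\<sigma>\<close> is applied first; being injective, it preserves
    vanishing.\<close>
  have "\<sigma> (rem1 A B C) = (?c3 * ?c2 + \<sigma> (\<sigma> (\<sigma> B))) * \<sigma> B + ?c3 * \<sigma> (\<sigma> A)"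
    by (simp add: rem1_def hom_simps)
  also have "\<dots> = (?c3 * ?c2 * ?c1 * ?c0) *
      (\<sigma> (\<sigma> z) * z + \<sigma> z - 1 - (\<sigma> z + z - 1 - \<sigma> w * (z * \<sigma> z)))"
    unfolding A2 B3 B1 by (simp add: hom_simps algebra_simps)
  finally have rem1: "\<sigma> (rem1 A B C) = (?c3 * ?c2 * ?c1 * ?c0) *
      (\<sigma> (\<sigma> z) * z + \<sigma> z - 1 - (\<sigma> z + z - 1 - \<sigma> w * (z * \<sigma> z)))" .
  have "rem2 A B C = 0 \<longleftrightarrow> \<sigma> z + z - 1 - \<sigma> w * (z * \<sigma> z) = 0"
    unfolding rem2 using nz assms by simp
  moreover have "rem1 A B C = 0 \<longleftrightarrow>
      \<sigma> (\<sigma> z) * z + \<sigma> z - 1 - (\<sigma> z + z - 1 - \<sigma> w * (z * \<sigma> z)) = 0"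
    using rem1 nz assms hom_eq_0_iff[of "rem1 A B C"]
    by (metis mult_eq_0_iff)
  ultimately show ?thesis
    unfolding maximality_conditions_def by (metis diff_zero)
qed

text \<open>The condition on \<open>z\<close> makes the constant coefficient \<open>m\<close> of the
  quotient a product of conjugates of \<open>z\<close> and \<open>C\<close>. Then
  \<open>rem1 A B C = 0\<close> determines \<open>A\<close> as such a product too, and
  \<open>m * A\<close> contains each conjugate of \<open>z\<close> and of \<open>C\<close> exactly
  once.\<close>

lemma rem0_eq_norm5:
  assumes "rem1 A B C = 0" "C \<noteq> 0"
    and z: "z = - \<sigma> B / (\<sigma> C * C)" and cond: "\<sigma> (\<sigma> z) * z + \<sigma> z - 1 = 0"
  shows "rem0 A B C = norm5 \<sigma> z * norm5 \<sigma> C"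
proof -
  have nz: "\<sigma> C \<noteq> 0" "\<sigma> (\<sigma> C) \<noteq> 0"
    using assms by (simp_all add: hom_simps)
  have B1: "\<sigma> B = - z * \<sigma> C * C"
    using nz assms by (simp add: z)
  have B2: "\<sigma> (\<sigma> B) = - \<sigma> z * \<sigma> (\<sigma> C) * \<sigma> C"
    using arg_cong[OF B1, of \<sigma>] by (simp only: hom_simps)
  have "\<sigma> (\<sigma> (\<sigma> (\<sigma> (\<sigma> B)))) = - \<sigma> (\<sigma> (\<sigma> (\<sigma> z))) * \<sigma> (\<sigma> (\<sigma> (\<sigma> (\<sigma> C)))) * \<sigma> (\<sigma> (\<sigma> (\<sigma> C)))"
    by (simp only: B1 hom_simps)
  then have B0: "B = - \<sigma> (\<sigma> (\<sigma> (\<sigma> z))) * C * \<sigma> (\<sigma> (\<sigma> (\<sigma> C)))"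
    by (simp only: five)
  have z1: "\<sigma> z = 1 - \<sigma> (\<sigma> z) * z"
    using cond by (simp add: algebra_simps)
  have m: "\<sigma> (\<sigma> C) * \<sigma> C + \<sigma> (\<sigma> B) = \<sigma> (\<sigma> C) * \<sigma> C * (\<sigma> (\<sigma> z) * z)"
    unfolding B2 by (subst z1) (simp add: algebra_simps)
  have "\<sigma> (\<sigma> C) * \<sigma> A = - ((\<sigma> (\<sigma> C) * \<sigma> C + \<sigma> (\<sigma> B)) * B)"
    using assms(1) unfolding rem1_def by (simp add: eq_neg_iff_add_eq_0 add.commute)
  also have "\<dots> = \<sigma> (\<sigma> C) * (\<sigma> C * (\<sigma> (\<sigma> z) * z) * (\<sigma> (\<sigma> (\<sigma> (\<sigma> z))) * C * \<sigma> (\<sigma> (\<sigma> (\<sigma> C)))))"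
    unfolding m by (subst B0) (simp add: algebra_simps)
  finally have A1: "\<sigma> A = \<sigma> C * (\<sigma> (\<sigma> z) * z) * (\<sigma> (\<sigma> (\<sigma> (\<sigma> z))) * C * \<sigma> (\<sigma> (\<sigma> (\<sigma> C))))"
    using nz by simp
  have "\<sigma> (\<sigma> (\<sigma> (\<sigma> (\<sigma> A)))) = C * (\<sigma> z * \<sigma> (\<sigma> (\<sigma> (\<sigma> z)))) * (\<sigma> (\<sigma> (\<sigma> z)) * \<sigma> (\<sigma> (\<sigma> (\<sigma> C))) * \<sigma> (\<sigma> (\<sigma> C)))"
    by (simp only: A1 hom_simps five)
  then have A: "A = C * (\<sigma> z * \<sigma> (\<sigma> (\<sigma> (\<sigma> z)))) * (\<sigma> (\<sigma> (\<sigma> z)) * \<sigma> (\<sigma> (\<sigma> (\<sigma> C))) * \<sigma> (\<sigma> (\<sigma> C)))"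
    by (simp only: five)
  show ?thesis
    unfolding rem0_def m by (subst A) (simp add: norm5_eq algebra_simps)
qed


subsection \<open>Roots and their norms\<close>

lemma lin_poly_eq_0_iff:
  assumes "d \<noteq> 0"
  shows "lin_poly \<sigma> a b c d x = 0 \<longleftrightarrow> cubic (- a / d) (- b / d) (- c / d) x = 0"
proof -
  have "lin_poly \<sigma> a b c d x = d * cubic (- a / d) (- b / d) (- c / d) x"
    using assms by (simp add: lin_poly_def cubic_def algebra_simps)
  then show ?thesis using assms by simp
qed

lemma rem_quotients_vanish_iff:
  assumes "a \<noteq> 0" "b \<noteq> 0" "c \<noteq> 0" "d \<noteq> 0"
    and "w = \<sigma> a * c / (\<sigma> b * b)" and "z = \<sigma> b * d / (\<sigma> c * c)"
  shows "rem1 (- a / d) (- b / d) (- c / d) = 0 \<and> rem2 (- a / d) (- b / d) (- c / d) = 0 \<longleftrightarrow>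
    maximality_conditions w z"
    and "maximality_conditions w z \<Longrightarrow>
      rem0 (- a / d) (- b / d) (- c / d) = - (norm5 \<sigma> z * norm5 \<sigma> (c / d))"
proof -
  let ?A = "- a / d" and ?B = "- b / d" and ?C = "- c / d"
  have nz: "?A \<noteq> 0" "?B \<noteq> 0" "?C \<noteq> 0" "\<sigma> d \<noteq> 0" "\<sigma> b \<noteq> 0" "\<sigma> c \<noteq> 0"
    using assms by (simp_all add: hom_simps)
  have w: "w = \<sigma> ?A * ?C / (\<sigma> ?B * ?B)" and z: "z = - \<sigma> ?B / (\<sigma> ?C * ?C)"
    using assms nz(4-) by (simp_all add: hom_divide hom_minus)
  show iff: "rem1 ?A ?B ?C = 0 \<and> rem2 ?A ?B ?C = 0 \<longleftrightarrow> maximality_conditions w z"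
    by (rule rem_vanish_iff[OF nz(1-3) w z])
  assume cond: "maximality_conditions w z"
  then have "rem0 ?A ?B ?C = norm5 \<sigma> z * norm5 \<sigma> ?C"
    using iff nz(3) z by (intro rem0_eq_norm5) (simp_all add: maximality_conditions_def)
  \<comment> \<open>The sign comes from \<open>?C = - c / d\<close>, as the norm is a product of
    five conjugates, an odd number.\<close>
  then show "rem0 ?A ?B ?C = - (norm5 \<sigma> z * norm5 \<sigma> (c / d))"
    using norm5_minus[of "c / d"] by simp
qed

text \<open>The two kernel bounds for \<open>cubic\<close> leave a gap between \<open>q ^ 2\<close>
  and \<open>q ^ 3\<close>, so the size \<open>q ^ 3\<close> detects exactly when the remainder is
  \<open>1\<close>.\<close>

lemma card_kernel_lin_poly:
  assumes "a \<noteq> 0" "b \<noteq> 0" "c \<noteq> 0" "d \<noteq> 0"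
    and "w = \<sigma> a * c / (\<sigma> b * b)" and "z = \<sigma> b * d / (\<sigma> c * c)"
  shows "card {x. lin_poly \<sigma> a b c d x = 0} = q ^ 3 \<longleftrightarrow>
      maximality_conditions w z \<and> norm5 \<sigma> z * norm5 \<sigma> (c / d) = - 1"
    and "card {x. lin_poly \<sigma> a b c d x = 0} \<noteq> q ^ 3 \<Longrightarrow>
      card {x. lin_poly \<sigma> a b c d x = 0} \<le> q ^ 2"
proof -
  let ?A = "- a / d" and ?B = "- b / d" and ?C = "- c / d"
  have K: "card {x. lin_poly \<sigma> a b c d x = 0} = card {x. cubic ?A ?B ?C x = 0}"
    using lin_poly_eq_0_iff[OF assms(4)] by simp
  have "q ^ 2 < q ^ 3"
    using q_gt_1 by (intro power_strict_increasing) auto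
  then have *: "card {x. lin_poly \<sigma> a b c d x = 0} = q ^ 3 \<longleftrightarrow>
      rem0 ?A ?B ?C = 1 \<and> rem1 ?A ?B ?C = 0 \<and> rem2 ?A ?B ?C = 0"
    unfolding K using card_kernel_cubic_le[of ?A ?B ?C] card_kernel_cubic_eq[of ?A ?B ?C]
    by fastforce
  show "card {x. lin_poly \<sigma> a b c d x = 0} = q ^ 3 \<longleftrightarrow>
      maximality_conditions w z \<and> norm5 \<sigma> z * norm5 \<sigma> (c / d) = - 1"
    unfolding * using rem_quotients_vanish_iff[OF assms] by (metis minus_minus)
  assume "card {x. lin_poly \<sigma> a b c d x = 0} \<noteq> q ^ 3"
  then show "card {x. lin_poly \<sigma> a b c d x = 0} \<le> q ^ 2"
    unfolding * unfolding K by (intro card_kernel_cubic_le) auto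
qed

text \<open>This is \<open>L\<close> with the operator \<open>\<sigma>\<close> replaced by
  \<open>\<theta> \<sigma>\<close>, whose powers produce the products of conjugates of
  \<open>\<theta>\<close>.\<close>

abbreviation lin_poly_twist :: "'a \<Rightarrow> 'a \<Rightarrow> 'a \<Rightarrow> 'a \<Rightarrow> 'a \<Rightarrow> 'a \<Rightarrow> 'a" where
  "lin_poly_twist a b c d \<theta> \<equiv>
     lin_poly \<sigma> a (b * \<theta>) (c * (\<theta> * \<sigma> \<theta>)) (d * (\<theta> * \<sigma> \<theta> * \<sigma> (\<sigma> \<theta>)))"

text \<open>Twisting leaves \<open>w\<close> and \<open>z\<close> unchanged and divides
  \<open>c / d\<close> by \<open>\<sigma> (\<sigma> \<theta>)\<close>, so only the norm condition
  changes, by a factor \<open>norm5 \<sigma> \<theta>\<close>.\<close>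

lemma card_kernel_lin_poly_twist:
  assumes "a \<noteq> 0" "b \<noteq> 0" "c \<noteq> 0" "d \<noteq> 0"
    and w: "w = \<sigma> a * c / (\<sigma> b * b)" and z: "z = \<sigma> b * d / (\<sigma> c * c)" and \<theta>: "\<theta> \<noteq> 0"
  shows "card {x. lin_poly_twist a b c d \<theta> x = 0} = q ^ 3 \<longleftrightarrow>
      maximality_conditions w z \<and> norm5 \<sigma> \<theta> = - (norm5 \<sigma> z * norm5 \<sigma> (c / d))"
    and "card {x. lin_poly_twist a b c d \<theta> x = 0} \<noteq> q ^ 3 \<Longrightarrow>
      card {x. lin_poly_twist a b c d \<theta> x = 0} \<le> q ^ 2"
proof -
  let ?b = "b * \<theta>" and ?c = "c * (\<theta> * \<sigma> \<theta>)" and ?d = "d * (\<theta> * \<sigma> \<theta> * \<sigma> (\<sigma> \<theta>))"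
  have nz: "\<theta> \<noteq> 0" "\<sigma> \<theta> \<noteq> 0" "\<sigma> (\<sigma> \<theta>) \<noteq> 0" "norm5 \<sigma> \<theta> \<noteq> 0"
    using \<theta> by (simp_all add: hom_simps norm5_eq_0_iff)
  have nz': "?b \<noteq> 0" "?c \<noteq> 0" "?d \<noteq> 0"
    using nz assms by simp_all
  have w': "w = \<sigma> a * ?c / (\<sigma> ?b * ?b)"
    using nz by (simp add: w hom_simps mult_ac)
  have z': "z = \<sigma> ?b * ?d / (\<sigma> ?c * ?c)"
    using nz by (simp add: z hom_simps mult_ac)
  have "?c / ?d = (c / d) / \<sigma> (\<sigma> \<theta>)"
    using nz by simp
  then have "norm5 \<sigma> (?c / ?d) = norm5 \<sigma> (c / d) / norm5 \<sigma> \<theta>"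
    by (simp only: norm5_divide norm5_hom)
  then have "norm5 \<sigma> z * norm5 \<sigma> (?c / ?d) = - 1 \<longleftrightarrow>
      norm5 \<sigma> z * norm5 \<sigma> (c / d) = - norm5 \<sigma> \<theta>"
    using nz(4) by (simp add: nonzero_divide_eq_eq)
  also have "\<dots> \<longleftrightarrow> norm5 \<sigma> \<theta> = - (norm5 \<sigma> z * norm5 \<sigma> (c / d))"
    by (metis minus_minus)
  finally show "card {x. lin_poly_twist a b c d \<theta> x = 0} = q ^ 3 \<longleftrightarrow>
      maximality_conditions w z \<and> norm5 \<sigma> \<theta> = - (norm5 \<sigma> z * norm5 \<sigma> (c / d))"
    using card_kernel_lin_poly(1)[OF assms(1) nz' w' z'] by simp
  show "card {x. lin_poly_twist a b c d \<theta> x = 0} \<noteq> q ^ 3 \<Longrightarrow>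
      card {x. lin_poly_twist a b c d \<theta> x = 0} \<le> q ^ 2"
    by (rule card_kernel_lin_poly(2)[OF assms(1) nz' w' z'])
qed

text \<open>With \<open>y = \<theta> * \<sigma> x / x\<close>, the products of \<open>y\<close> and
  its conjugates telescope in \<open>x\<close>.\<close>

lemma lin_poly_twist_eq:
  assumes "x \<noteq> 0"
  shows "lin_poly_twist a b c d \<theta> x = x * proj_poly \<sigma> a b c d (\<theta> * \<sigma> x / x)"
proof -
  have "\<sigma> x \<noteq> 0" "\<sigma> (\<sigma> x) \<noteq> 0"
    using assms by (simp_all add: hom_simps)
  then show ?thesis
    using assms by (simp add: lin_poly_def proj_poly_def hom_simps field_simps)
qed

section \<open>Counting the roots of the projective polynomial by norm\<close>

lemma card_fixed_nonzero: "card {n. \<sigma> n = n \<and> n \<noteq> 0} = q - 1"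
proof -
  have "{n. \<sigma> n = n \<and> n \<noteq> 0} = {n. \<sigma> n = n} - {0}" by auto
  then show ?thesis
    by (simp add: card_fixed hom_zero)
qed

text \<open>By Hilbert 90, the roots with the same norm as \<open>\<theta>\<close> are the values \<open>\<theta> \<sigma> x / x\<close> for \<open>x\<close> in the
  kernel of the twisted polynomial, and \<open>x\<close> is unique up to factors from the fixed field.\<close>

lemma card_roots_of_norm:
  assumes \<theta>: "\<theta> \<noteq> 0"
  shows "card {y. proj_poly \<sigma> a b c d y = 0 \<and> norm5 \<sigma> y = norm5 \<sigma> \<theta>} * (q - 1) + 1
    = card {x. lin_poly_twist a b c d \<theta> x = 0}"
proof -
  define R where "R = {y. proj_poly \<sigma> a b c d y = 0 \<and> norm5 \<sigma> y = norm5 \<sigma> \<theta>}"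
  define V where "V y = {x. x \<noteq> 0 \<and> \<sigma> x = (y / \<theta>) * x}" for y
  have V_card: "card (V y) = q - 1" if "y \<in> R" for y
  proof -
    have "norm5 \<sigma> (y / \<theta>) = 1"
      using that \<theta> by (simp add: R_def norm5_divide norm5_eq_0_iff)
    then obtain u where u: "u \<noteq> 0" "\<sigma> u = (y / \<theta>) * u"
      by (rule hilbert_90)
    have "\<sigma> u \<noteq> 0" using u(1) hom_eq_0_iff by blast
    then have y\<theta>: "y / \<theta> = \<sigma> u / u" "y / \<theta> \<noteq> 0" using u by auto
    have "bij_betw (\<lambda>n. n * u) {n. \<sigma> n = n \<and> n \<noteq> 0} (V y)"
    proof (rule bij_betw_byWitness[where f' = "\<lambda>x. x / u"])
      show "(\<lambda>n. n * u) ` {n. \<sigma> n = n \<and> n \<noteq> 0} \<subseteq> V y"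
        using u(1) by (auto simp: V_def hom_mult u(2) mult_ac)
      show "(\<lambda>x. x / u) ` V y \<subseteq> {n. \<sigma> n = n \<and> n \<noteq> 0}"
        using u(1) y\<theta>(2) by (auto simp: V_def hom_divide u(2))
    qed (use u(1) in auto)
    from bij_betw_same_card[OF this] show ?thesis
      using card_fixed_nonzero by simp
  qed
  have kernel: "{x. lin_poly_twist a b c d \<theta> x = 0} - {0} = (\<Union>y\<in>R. V y)"
  proof (intro equalityI subsetI)
    fix x assume "x \<in> {x. lin_poly_twist a b c d \<theta> x = 0} - {0}"
    then have x: "x \<noteq> 0" "proj_poly \<sigma> a b c d (\<theta> * \<sigma> x / x) = 0"
      using lin_poly_twist_eq[of x a b \<theta> c d] by auto
    have "norm5 \<sigma> (\<theta> * \<sigma> x / x) = norm5 \<sigma> \<theta>"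
      using x(1) by (simp add: norm5_divide norm5_mult norm5_hom norm5_eq_0_iff)
    with x have "\<theta> * \<sigma> x / x \<in> R" by (simp add: R_def)
    moreover have "x \<in> V (\<theta> * \<sigma> x / x)"
      using x \<theta> by (simp add: V_def)
    ultimately show "x \<in> (\<Union>y\<in>R. V y)" by blast
  next
    fix x assume "x \<in> (\<Union>y\<in>R. V y)"
    then obtain y where y: "y \<in> R" "x \<noteq> 0" "\<sigma> x = (y / \<theta>) * x"
      by (auto simp: V_def)
    then have "\<theta> * \<sigma> x / x = y" using \<theta> by simp
    then show "x \<in> {x. lin_poly_twist a b c d \<theta> x = 0} - {0}"
      using y lin_poly_twist_eq[of x a b \<theta> c d] by (simp add: R_def)
  qed
  have "card (\<Union>y\<in>R. V y) = (\<Sum>y\<in>R. card (V y))"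
  proof (rule card_UN_disjoint)
    show "\<forall>i\<in>R. \<forall>j\<in>R. i \<noteq> j \<longrightarrow> V i \<inter> V j = {}"
      using \<theta> by (auto simp: V_def)
  qed simp_all
  also have "\<dots> = card R * (q - 1)"
    using V_card by simp
  finally have *: "card ({x. lin_poly_twist a b c d \<theta> x = 0} - {0}) = card R * (q - 1)"
    unfolding kernel .
  \<comment> \<open>The summand \<open>1\<close> in the count is the zero vector of the
    kernel.\<close>
  have zero: "0 \<in> {x. lin_poly_twist a b c d \<theta> x = 0}"
    by (simp add: lin_poly_def hom_zero)
  have "Suc (card ({x. lin_poly_twist a b c d \<theta> x = 0} - {0})) =
      card {x. lin_poly_twist a b c d \<theta> x = 0}"
    by (rule card_Suc_Diff1) (use zero in simp_all)
  then show ?thesis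
    unfolding * by (simp add: R_def)
qed

text \<open>The products \<open>1\<close>, \<open>y\<close>, \<open>y * \<sigma> y\<close>, ...
  satisfy the recurrence of the cubic, and the fifth one is the norm of \<open>y\<close>. Since
  \<open>rem1\<close> and \<open>rem2\<close> vanish, it equals \<open>rem0\<close>.\<close>

lemma norm5_root:
  assumes "maximality_conditions w z" "a \<noteq> 0" "b \<noteq> 0" "c \<noteq> 0" "d \<noteq> 0"
    and w: "w = \<sigma> a * c / (\<sigma> b * b)" and z: "z = \<sigma> b * d / (\<sigma> c * c)"
    and root: "proj_poly \<sigma> a b c d y = 0"
  shows "norm5 \<sigma> y = - (norm5 \<sigma> z * norm5 \<sigma> (c / d))"
proof -
  let ?A = "- a / d" and ?B = "- b / d" and ?C = "- c / d"
  have "d * (y * \<sigma> y * \<sigma> (\<sigma> y)) =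
      d * (?C * (y * \<sigma> y) + ?B * y + ?A * 1) + proj_poly \<sigma> a b c d y"
    using assms(5) by (simp add: proj_poly_def algebra_simps)
  then have s3: "y * \<sigma> y * \<sigma> (\<sigma> y) = ?C * (y * \<sigma> y) + ?B * y + ?A * 1"
    using assms(5) root by (metis add.right_neutral mult_left_cancel)
  have t3: "\<sigma> y * \<sigma> (\<sigma> y) * \<sigma> (\<sigma> (\<sigma> y)) = \<sigma> ?C * (\<sigma> y * \<sigma> (\<sigma> y)) + \<sigma> ?B * \<sigma> y + \<sigma> ?A * 1"
    using arg_cong[OF s3, of \<sigma>] by (simp only: hom_add hom_mult hom_one)
  have u3: "\<sigma> (\<sigma> y) * \<sigma> (\<sigma> (\<sigma> y)) * \<sigma> (\<sigma> (\<sigma> (\<sigma> y))) =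
      \<sigma> (\<sigma> ?C) * (\<sigma> (\<sigma> y) * \<sigma> (\<sigma> (\<sigma> y))) + \<sigma> (\<sigma> ?B) * \<sigma> (\<sigma> y) + \<sigma> (\<sigma> ?A) * 1"
    using arg_cong[OF t3, of \<sigma>] by (simp only: hom_add hom_mult hom_one)
  \<comment> \<open>Applying \<open>\<sigma>\<close> loses the leading factor \<open>y\<close> of
    each product; multiplication by \<open>y\<close> restores it.\<close>
  have s4: "y * (\<sigma> y * \<sigma> (\<sigma> y) * \<sigma> (\<sigma> (\<sigma> y))) =
      \<sigma> ?C * (y * \<sigma> y * \<sigma> (\<sigma> y)) + \<sigma> ?B * (y * \<sigma> y) + \<sigma> ?A * y"
    unfolding t3 by (simp only: algebra_simps mult_1_left mult_1_right)
  have s5: "y * \<sigma> y * (\<sigma> (\<sigma> y) * \<sigma> (\<sigma> (\<sigma> y)) * \<sigma> (\<sigma> (\<sigma> (\<sigma> y)))) =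
      \<sigma> (\<sigma> ?C) * (y * (\<sigma> y * \<sigma> (\<sigma> y) * \<sigma> (\<sigma> (\<sigma> y)))) + \<sigma> (\<sigma> ?B) * (y * \<sigma> y * \<sigma> (\<sigma> y))
        + \<sigma> (\<sigma> ?A) * (y * \<sigma> y)"
    unfolding u3 by (simp only: algebra_simps mult_1_left mult_1_right)
  have "norm5 \<sigma> y = y * \<sigma> y * (\<sigma> (\<sigma> y) * \<sigma> (\<sigma> (\<sigma> y)) * \<sigma> (\<sigma> (\<sigma> (\<sigma> y))))"
    by (simp only: norm5_eq mult.assoc)
  also have "\<dots> = rem0 ?A ?B ?C * 1 + rem1 ?A ?B ?C * y + rem2 ?A ?B ?C * (y * \<sigma> y)"
    by (rule recurrence_fifth[OF s3 s4 s5])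
  finally show ?thesis
    using rem_quotients_vanish_iff[OF assms(2-7)] assms(1) by simp
qed

lemma card_roots_proj_poly:
  assumes nz: "a \<noteq> 0" "b \<noteq> 0" "c \<noteq> 0" "d \<noteq> 0"
    and w: "w = \<sigma> a * c / (\<sigma> b * b)" and z: "z = \<sigma> b * d / (\<sigma> c * c)"
  shows "card {y. proj_poly \<sigma> a b c d y = 0} = q ^ 2 + q + 1 \<longleftrightarrow> maximality_conditions w z"
proof -
  obtain r where r: "q = Suc r" "r > 0"
    using q_gt_1 by (cases q) auto
  note twist = card_kernel_lin_poly_twist[OF nz w z]
  show ?thesis
  proof
    assume conds: "maximality_conditions w z"
    \<comment> \<open>Chosen so that its norm is the one for which the twist has the maximal
      kernel.\<close>
    define \<theta> where "\<theta> = - (z * (c / d))"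
    have \<theta>: "\<theta> \<noteq> 0"
      using nz by (simp add: \<theta>_def z hom_simps)
    have N\<theta>: "norm5 \<sigma> \<theta> = - (norm5 \<sigma> z * norm5 \<sigma> (c / d))"
      by (simp only: \<theta>_def norm5_minus norm5_mult)
    then have "card {x. lin_poly_twist a b c d \<theta> x = 0} = q ^ 3"
      using twist(1)[OF \<theta>] conds by simp
    moreover have "{y. proj_poly \<sigma> a b c d y = 0 \<and> norm5 \<sigma> y = norm5 \<sigma> \<theta>}
        = {y. proj_poly \<sigma> a b c d y = 0}"
      using norm5_root[OF conds nz w z] N\<theta> by auto
    ultimately have "card {y. proj_poly \<sigma> a b c d y = 0} * r + 1 = q ^ 3"
      using card_roots_of_norm[OF \<theta>, of a b c d] r by simp
    also have "q ^ 3 = (q ^ 2 + q + 1) * r + 1"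
      by (simp add: r numeral_eq_Suc algebra_simps)
    finally show "card {y. proj_poly \<sigma> a b c d y = 0} = q ^ 2 + q + 1"
      using r(2) by (metis add_right_cancel mult_right_cancel neq0_conv)
  next
    assume count: "card {y. proj_poly \<sigma> a b c d y = 0} = q ^ 2 + q + 1"
    show "maximality_conditions w z"
    proof (rule ccontr)
      assume not: "\<not> maximality_conditions w z"
      define R where "R n = {y. proj_poly \<sigma> a b c d y = 0 \<and> norm5 \<sigma> y = n}" for n
      have R_le: "card (R n) \<le> q + 1" for n
      proof (cases "R n = {}")
        case False
        then obtain \<theta> where \<theta>: "proj_poly \<sigma> a b c d \<theta> = 0" "norm5 \<sigma> \<theta> = n"
          by (auto simp: R_def)
        then have "\<theta> \<noteq> 0"
          using nz by (auto simp: proj_poly_def)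
        then have "card (R n) * r + 1 \<le> q ^ 2"
          using card_roots_of_norm[of \<theta> a b c d] twist[of \<theta>] not \<theta> r by (simp add: R_def)
        also have "q ^ 2 = (q + 1) * r + 1"
          by (simp add: r numeral_eq_Suc algebra_simps)
        finally show ?thesis
          using r(2) by (metis add_le_cancel_right mult_le_cancel2)
      qed simp
      \<comment> \<open>As \<open>a\<close> is nonzero, \<open>0\<close> is not a root; hence all
        norms of roots are among the \<open>q - 1\<close> nonzero fixed elements.\<close>
      have "{y. proj_poly \<sigma> a b c d y = 0} \<subseteq> (\<Union>n\<in>{n. \<sigma> n = n \<and> n \<noteq> 0}. R n)"
        using nz by (auto simp: R_def hom_norm5 norm5_eq_0_iff proj_poly_def)
      then have "card {y. proj_poly \<sigma> a b c d y = 0} \<le> card (\<Union>n\<in>{n. \<sigma> n = n \<and> n \<noteq> 0}. R n)"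
        by (intro card_mono) auto
      also have "\<dots> \<le> (\<Sum>n\<in>{n. \<sigma> n = n \<and> n \<noteq> 0}. card (R n))"
        by (rule card_UN_le) simp
      also have "\<dots> \<le> (q - 1) * (q + 1)"
        using sum_bounded_above[of "{n. \<sigma> n = n \<and> n \<noteq> 0}" "\<lambda>n. card (R n)" "q + 1"] R_le
        by (simp add: card_fixed_nonzero)
      also have "\<dots> < q ^ 2 + q + 1"
        by (simp add: r numeral_eq_Suc algebra_simps)
      finally show False
        using count by simp
    qed
  qed
qed

end


section \<open>Generators of the Galois group\<close>

text \<open>Multiplication by a nonzero \<open>x\<close> permutes the nonzero elements of
  \<open>F\<close>; comparing their products gives Fermat's identity.\<close>

lemma is_subfield_power_card:
  assumes "is_subfield F" "finite F" "x \<in> F"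
  shows "x ^ card F = x"
proof (cases "x = 0")
  case True
  then show ?thesis
    using assms by (auto simp: card_gt_0_iff)
next
  case False
  have F: "0 \<in> F" "\<And>x y. x \<in> F \<Longrightarrow> y \<in> F \<Longrightarrow> x * y \<in> F" "\<And>x. x \<in> F \<Longrightarrow> inverse x \<in> F"
    using assms(1) by (auto simp: is_subfield_def)
  have "(\<Prod>y\<in>F - {0}. x * y) = (\<Prod>y\<in>F - {0}. y)"
    by (rule prod.reindex_bij_witness[of _ "\<lambda>y. inverse x * y" "\<lambda>y. x * y"])
      (use False F assms(3) in auto)
  moreover have "(\<Prod>y\<in>F - {0}. x * y) = x ^ (card F - 1) * (\<Prod>y\<in>F - {0}. y)"
    using assms(2) F(1) by (simp add: prod.distrib)
  moreover have "(\<Prod>y\<in>F - {0}. y) \<noteq> 0"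
    using assms(2) by simp
  ultimately have "x ^ (card F - 1) = 1"
    by simp
  moreover have "card F > 0"
    using assms(2,3) by (auto simp: card_gt_0_iff)
  ultimately show ?thesis
    by (metis Suc_pred' mult.right_neutral power_Suc One_nat_def)
qed

lemma card_power_fixed_le:
  assumes "q > 1"
  shows "card {x :: 'a::idom. x ^ q = x} \<le> q"
proof -
  define p :: "'a poly" where "p = Polynomial.monom 1 q - Polynomial.monom 1 1"
  have "Polynomial.coeff p q = 1"
    using assms by (simp add: p_def)
  then have "p \<noteq> 0" by auto
  have "degree p \<le> q"
    unfolding p_def using assms by (intro degree_diff_le) (auto simp: degree_monom_le[THEN order_trans])
  moreover have "{x. poly p x = 0} = {x. x ^ q = x}"
    by (auto simp: p_def poly_monom)
  ultimately show ?thesis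
    using card_poly_roots_bound[OF \<open>p \<noteq> 0\<close>] by simp
qed

text \<open>The characteristic divides the size of the field, so it is the prime of which
  \<open>q\<close> is a power, and \<open>x \<mapsto> x ^ q\<close> is an iterate of
  Frobenius.\<close>

lemma primepow_power_add:
  fixes x y :: "'a::finite_field"
  assumes "primepow q" "CARD('a) = q ^ n"
  shows "(x + y) ^ q = x ^ q + y ^ q"
proof -
  obtain p k where p: "Factorial_Ring.prime p" "q = p ^ k"
    using assms(1) by (auto simp: primepow_def)
  have "CHAR('a) dvd (p ^ k) ^ n"
    using CHAR_dvd_CARD[where 'a = 'a] assms(2) p(2) by simp
  then have "CHAR('a) dvd p"
    using CHAR_prime[where 'a = 'a] prime_dvd_power by blast
  then have "CHAR('a) = p"
    using p(1) CHAR_prime[where 'a = 'a] primes_dvd_imp_eq by blast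
  then show ?thesis
    using p freshmans_dream'[where 'a = 'a] by blast
qed

section \<open>The Galois group and conjugates under the Frobenius map\<close>

lemma group_Gal: "group (Gal F)"
proof (rule groupI)
  fix f assume f: "f \<in> carrier (Gal F)"
  then have bij: "bij f" and hom: "\<And>x y. f (x + y) = f x + f y" "\<And>x y. f (x * y) = f x * f y"
    "\<And>x. x \<in> F \<Longrightarrow> f x = x"
    by (auto simp: Gal_def)
  have inv: "f (inv_into UNIV f x) = x" "inv_into UNIV f (f x) = x" for x
    using bij by (simp_all add: bij_is_surj surj_f_inv_f bij_is_inj)
  have "inv_into UNIV f \<in> carrier (Gal F)"
    unfolding Gal_def using bij hom inv by (auto simp: bij_imp_bij_inv) (metis inv hom)+
  moreover have "inv_into UNIV f \<otimes>\<^bsub>Gal F\<^esub> f = \<one>\<^bsub>Gal F\<^esub>"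
    using inv by (auto simp: Gal_def)
  ultimately show "\<exists>g\<in>carrier (Gal F). g \<otimes>\<^bsub>Gal F\<^esub> f = \<one>\<^bsub>Gal F\<^esub>"
    by blast
qed (auto simp: Gal_def bij_comp comp_assoc)

text \<open>Used for the Frobenius map \<open>f\<close>, to bound the fixed field of a generator
  from above.\<close>

lemma generate_Gal_fixed:
  assumes "f \<in> generate (Gal F) {\<sigma>}" "\<sigma> \<in> carrier (Gal F)" "\<sigma> x = x"
  shows "f x = x"
  using assms(1)
proof (induction rule: generate.induct)
  case (inv h)
  interpret group "Gal F" by (rule group_Gal)
  have "inv\<^bsub>Gal F\<^esub> \<sigma> \<otimes>\<^bsub>Gal F\<^esub> \<sigma> = \<one>\<^bsub>Gal F\<^esub>"
    using assms(2) by (rule l_inv)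
  then have "(inv\<^bsub>Gal F\<^esub> \<sigma> \<circ> \<sigma>) x = x"
    by (simp add: Gal_def)
  then show ?case
    using inv assms(3) by simp
qed (use assms(3) in \<open>simp_all add: Gal_def\<close>)

lemma prod_linear_factors_5:
  fixes t :: "'a::comm_ring_1"
  shows "(t - x0) * (t - x1) * (t - x2) * (t - x3) * (t - x4) = t ^ 5
    - (x0 + x1 + x2 + x3 + x4) * t ^ 4
    + (x0*x1 + x0*x2 + x0*x3 + x0*x4 + x1*x2 + x1*x3 + x1*x4 + x2*x3 + x2*x4 + x3*x4) * t ^ 3
    - (x0*x1*x2 + x0*x1*x3 + x0*x1*x4 + x0*x2*x3 + x0*x2*x4 + x0*x3*x4
       + x1*x2*x3 + x1*x2*x4 + x1*x3*x4 + x2*x3*x4) * t ^ 2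
    + (x0*x1*x2*x3 + x0*x1*x2*x4 + x0*x1*x3*x4 + x0*x2*x3*x4 + x1*x2*x3*x4) * t
    - x0*x1*x2*x3*x4"
  by (simp add: numeral_eq_Suc algebra_simps)

text \<open>Every \<open>\<sigma> x\<close> is a root of the polynomial \<open>\<Prod>i<5. T - \<phi>\<^sup>i x\<close>, whose coefficients are fixed
  by \<open>\<sigma>\<close>.\<close>

lemma endomorphism_conjugate_cases:
  assumes "field_endomorphism \<sigma>" "field_endomorphism \<phi>"
    and \<phi>5: "\<phi> (\<phi> (\<phi> (\<phi> (\<phi> x)))) = x"
    and fixed: "\<And>y. \<phi> y = y \<Longrightarrow> \<sigma> y = y"
  shows "\<exists>i<5. \<sigma> x = (\<phi> ^^ i) x"
proof -
  interpret S: field_endomorphism \<sigma> by fact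
  interpret P: field_endomorphism \<phi> by fact
  have S_power: "\<sigma> (t ^ n) = \<sigma> t ^ n" for t n
    by (induction n) (simp_all add: S.hom_simps)
  define x1 where "x1 = \<phi> x"
  define x2 where "x2 = \<phi> x1"
  define x3 where "x3 = \<phi> x2"
  define x4 where "x4 = \<phi> x3"
  have \<phi>: "\<phi> x = x1" "\<phi> x1 = x2" "\<phi> x2 = x3" "\<phi> x3 = x4" "\<phi> x4 = x"
    using \<phi>5 by (simp_all add: x1_def x2_def x3_def x4_def)
  note \<phi>_simps = P.hom_add P.hom_mult \<phi>
  define e1 where "e1 = x + x1 + x2 + x3 + x4"
  define e2 where "e2 = x*x1 + x*x2 + x*x3 + x*x4 + x1*x2 + x1*x3 + x1*x4 + x2*x3 + x2*x4 + x3*x4"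
  define e3 where "e3 = x*x1*x2 + x*x1*x3 + x*x1*x4 + x*x2*x3 + x*x2*x4 + x*x3*x4
    + x1*x2*x3 + x1*x2*x4 + x1*x3*x4 + x2*x3*x4"
  define e4 where "e4 = x*x1*x2*x3 + x*x1*x2*x4 + x*x1*x3*x4 + x*x2*x3*x4 + x1*x2*x3*x4"
  define e5 where "e5 = x*x1*x2*x3*x4"
  \<comment> \<open>The map \<open>\<phi>\<close> permutes \<open>x, x1, ..., x4\<close> cyclically,
    and the \<open>e\<close>s are their elementary symmetric functions.\<close>
  have "\<phi> e1 = e1" "\<phi> e2 = e2" "\<phi> e3 = e3" "\<phi> e4 = e4" "\<phi> e5 = e5"
    unfolding e1_def e2_def e3_def e4_def e5_def \<phi>_simps by (simp_all only: ac_simps)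
  then have \<sigma>e: "\<sigma> e1 = e1" "\<sigma> e2 = e2" "\<sigma> e3 = e3" "\<sigma> e4 = e4" "\<sigma> e5 = e5"
    by (simp_all add: fixed)
  have prod: "(t - x) * (t - x1) * (t - x2) * (t - x3) * (t - x4) =
      t ^ 5 - e1 * t ^ 4 + e2 * t ^ 3 - e3 * t ^ 2 + e4 * t - e5" for t
    unfolding e1_def e2_def e3_def e4_def e5_def by (rule prod_linear_factors_5)
  have "\<sigma> (x ^ 5 - e1 * x ^ 4 + e2 * x ^ 3 - e3 * x ^ 2 + e4 * x - e5) = \<sigma> 0"
    using prod[of x] by simp
  then have "\<sigma> x ^ 5 - e1 * \<sigma> x ^ 4 + e2 * \<sigma> x ^ 3 - e3 * \<sigma> x ^ 2 + e4 * \<sigma> x - e5 = 0"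
    by (simp only: S.hom_add S.hom_diff S.hom_mult S.hom_zero S_power \<sigma>e)
  then have "(\<sigma> x - x) * (\<sigma> x - x1) * (\<sigma> x - x2) * (\<sigma> x - x3) * (\<sigma> x - x4) = 0"
    using prod[of "\<sigma> x"] by simp
  then have "\<sigma> x = x \<or> \<sigma> x = x1 \<or> \<sigma> x = x2 \<or> \<sigma> x = x3 \<or> \<sigma> x = x4"
    by auto
  moreover have "(\<phi> ^^ 0) x = x" "(\<phi> ^^ 1) x = x1" "(\<phi> ^^ 2) x = x2" "(\<phi> ^^ 3) x = x3"
    "(\<phi> ^^ 4) x = x4"
    using \<phi> by (simp_all add: numeral_eq_Suc)
  moreover have "(0::nat) < 5" "(1::nat) < 5" "(2::nat) < 5" "(3::nat) < 5" "(4::nat) < 5"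
    by simp_all
  ultimately show ?thesis
    by metis
qed

text \<open>Comparison with the Frobenius map \<open>\<phi>\<close>, itself in the Galois group,
  shows that the fixed field of \<open>\<sigma>\<close> is \<open>F\<close> and that
  \<open>\<sigma>\<close> has fifth power \<open>id\<close>.\<close>

lemma cyclic_quintic_Gal_generator:
  fixes F :: "'a::finite_field set"
  assumes q: "primepow q" and F: "is_subfield F" "card F = q" and K: "CARD('a) = q ^ 5"
    and \<sigma>: "\<sigma> \<in> carrier (Gal F)" and gen: "generate (Gal F) {\<sigma>} = carrier (Gal F)"
  shows "cyclic_quintic \<sigma> q"
proof -
  define \<phi> :: "'a \<Rightarrow> 'a" where "\<phi> x = x ^ q" for x
  have q1: "q > 1"
    using primepow_gt_Suc_0[OF q] by simp
  have \<sigma>_bij: "bij \<sigma>" and \<sigma>_add: "\<And>x y. \<sigma> (x + y) = \<sigma> x + \<sigma> y"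
    and \<sigma>_mult: "\<And>x y. \<sigma> (x * y) = \<sigma> x * \<sigma> y" and \<sigma>_F: "\<And>x. x \<in> F \<Longrightarrow> \<sigma> x = x"
    using \<sigma> by (auto simp: Gal_def)
  have "\<sigma> 1 = 1"
    using F(1) \<sigma>_F by (auto simp: is_subfield_def)
  then interpret field_endomorphism \<sigma>
    by unfold_locales (simp_all add: \<sigma>_add \<sigma>_mult)
  have \<phi>_endo: "field_endomorphism \<phi>"
    using primepow_power_add[OF q K]
    by unfold_locales (simp_all add: \<phi>_def power_mult_distrib)
  have \<phi>5: "\<phi> (\<phi> (\<phi> (\<phi> (\<phi> x)))) = x" for x
    using finite_field_power_card_eq_same[of x] unfolding K
    by (simp add: \<phi>_def numeral_eq_Suc mult_ac flip: power_mult)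
  have \<phi>_F: "\<phi> x = x" if "x \<in> F" for x
    using is_subfield_power_card[OF F(1) _ that] F(2) by (simp add: \<phi>_def)
  have "bij \<phi>"
    by (rule o_bij[of "\<lambda>x. \<phi> (\<phi> (\<phi> (\<phi> x)))"]) (auto simp: \<phi>5)
  then have "\<phi> \<in> carrier (Gal F)"
    using \<phi>_F field_endomorphism.hom_add[OF \<phi>_endo] field_endomorphism.hom_mult[OF \<phi>_endo]
    by (simp add: Gal_def)
  then have "{x. \<sigma> x = x} \<subseteq> {x. \<phi> x = x}"
    using gen \<sigma> generate_Gal_fixed by blast
  moreover have "F \<subseteq> {x. \<sigma> x = x}"
    using \<sigma>_F by blast
  moreover have "{x. \<phi> x = x} = F"
  \<comment> \<open>\<open>F\<close> is contained in the roots of \<open>x ^ q = x\<close>, of which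
    there are at most \<open>q = card F\<close>.\<close>
  proof (rule card_seteq[symmetric])
    show "card {x. \<phi> x = x} \<le> card F"
      using card_power_fixed_le[OF q1, where 'a = 'a] F(2) by (simp add: \<phi>_def)
  qed (use \<phi>_F in auto)
  ultimately have fixed: "{x. \<sigma> x = x} = F" "{x. \<phi> x = x} = F"
    by auto
  have comm: "\<sigma> (\<phi> x) = \<phi> (\<sigma> x)" for x
  proof -
    have "\<sigma> (x ^ n) = \<sigma> x ^ n" for n
      by (induction n) (simp_all add: hom_simps)
    then show ?thesis
      by (simp add: \<phi>_def)
  qed
  \<comment> \<open>The exponent \<open>i\<close> may depend on \<open>x\<close>, but
    \<open>\<sigma>\<close> commutes with \<open>\<phi>\<close>, so five applications of
    \<open>\<sigma>\<close> to this \<open>x\<close> amount to \<open>5 * i\<close> applications of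
    \<open>\<phi>\<close>.\<close>
  have five: "\<sigma> (\<sigma> (\<sigma> (\<sigma> (\<sigma> x)))) = x" for x
  proof -
    have "\<And>y. \<phi> y = y \<Longrightarrow> \<sigma> y = y"
      using fixed by blast
    from endomorphism_conjugate_cases[OF field_endomorphism_axioms \<phi>_endo \<phi>5 this]
    obtain i where i: "\<sigma> x = (\<phi> ^^ i) x" by blast
    have "\<sigma> ((\<phi> ^^ j) x) = (\<phi> ^^ j) (\<sigma> x)" for j
      by (induction j) (simp_all add: comm)
    then have step: "\<sigma> ((\<phi> ^^ j) x) = (\<phi> ^^ (j + i)) x" for j
      using i by (simp add: funpow_add)
    have "\<sigma> (\<sigma> (\<sigma> (\<sigma> (\<sigma> x)))) = (\<phi> ^^ (i + i + i + i + i)) x"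
      by (simp only: i step)
    also have "i + i + i + i + i = 5 * i"
      by simp
    also have "(\<phi> ^^ (5 * i)) x = ((\<phi> ^^ 5) ^^ i) x"
      by (simp add: funpow_mult mult.commute)
    also have "\<phi> ^^ 5 = id"
      by (auto simp: numeral_eq_Suc \<phi>5)
    also have "(id ^^ i) x = x"
      by (induction i) simp_all
    finally show ?thesis .
  qed
  show ?thesis
    by unfold_locales (use five fixed(1) F(2) K in simp_all)
qed

theorem theorem16:
  fixes F :: "'a::finite_field set"
    and q :: nat
    and \<sigma> :: "'a \<Rightarrow> 'a"
    and a b c d w z :: 'a
  assumes "primepow q"
    and "is_subfield F" and "card F = q" and "CARD('a) = q ^ 5"
    and "\<sigma> \<in> carrier (Gal F)" and "generate (Gal F) {\<sigma>} = carrier (Gal F)"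
    and "a * b * c * d \<noteq> 0"
    and "w = (\<sigma> a * c) / (\<sigma> b * b)"
    and "z = (\<sigma> b * d) / (\<sigma> c * c)"
  shows "(card {y. proj_poly \<sigma> a b c d y = 0} = q ^ 2 + q + 1 \<longleftrightarrow>
            \<sigma> (\<sigma> z) * z + \<sigma> z - 1 = 0 \<and> \<sigma> z + z - 1 - \<sigma> w * (z * \<sigma> z) = 0) \<and>
         (card {x. lin_poly \<sigma> a b c d x = 0} = q ^ 3 \<longleftrightarrow>
            \<sigma> (\<sigma> z) * z + \<sigma> z - 1 = 0 \<and> \<sigma> z + z - 1 - \<sigma> w * (z * \<sigma> z) = 0 \<and>
            norm5 \<sigma> z * norm5 \<sigma> (c / d) = - 1)"
proof -
  interpret cyclic_quintic \<sigma> q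
    using assms(1-6) by (rule cyclic_quintic_Gal_generator)
  have "a \<noteq> 0" "b \<noteq> 0" "c \<noteq> 0" "d \<noteq> 0"
    using assms(7) by auto
  from card_roots_proj_poly[OF this assms(8,9)] card_kernel_lin_poly(1)[OF this assms(8,9)]
  show ?thesis
    by (simp add: maximality_conditions_def)
qed

end
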